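(* Let $m,n\ge 2$ be natural numbers with $m<n$, and let $G\le \operatorname{Sym}(m)$ and $H\le \operatorname{Sym}(n)$. Suppose that: (1) there exists a prefix code $\widetilde{A}$ of $\mathfrak{C}_m$ with $|\widetilde{A}|=n$; (2) the root group $\mathcal{R}_G(\widetilde{A})$ is well defined; and (3) $\mathcal{R}_G(\widetilde{A})$ and $H$ are cyclically isomorphic. Then $V_n(H)$ embeds (as a group) in $V_m(G)$.
   Context: For $r\ge 2$ let $\mathcal{A}_r=\{0,1,\dots,r-1\}$ with the order $0<1<\dots<r-1$, let $\mathcal{A}_r^*$ be the set of finite words over $\mathcal{A}_r$ (including the empty word), and let $\mathfrak{C}_r=\mathcal{A}_r^{\mathbb{N}}$ (infinite words, product topology; a Cantor space). For $u\in\mathcal{A}_r^*$ and $v$ a finite or infinite word, $uv$ denotes concatenation, and $u\le_{pref} v$ means $v=uw$ for some word $w$. A (complete) prefix code of $\mathfrak{C}_r$ is a finite set $S\subset\mathcal{A}_r^*$ such that every infinite word $\zeta\in\mathfrak{C}_r$ has exactly one $s\in S$ with $s\le_{pref}\zeta$. A permutation $\sigma\in\operatorname{Sym}(r)$ acts on finite or infinite words letterwise: $\sigma(z_1z_2z_3\cdots)=\sigma(z_1)\sigma(z_2)\sigma(z_3)\cdots$. For $H\le\operatorname{Sym}(r)$, the symmetric Thompson group $V_r(H)$ is the group (under composition) of homeomorphisms of $\mathfrak{C}_r$ described by tables: a table consists of two prefix codes $P=\{p_1,\dots,p_k\}$ and $Q=\{q_1,\dots,q_k\}$ of $\mathfrak{C}_r$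 of the same size together with $\sigma_i,\tau_i\in H$ ($1\le i\le k$), and it describes the homeomorphism sending $p_i\,\sigma_i(u)\mapsto q_i\,\tau_i(u)$ for all $u\in\mathfrak{C}_r$ and all $i$ (equivalently $p_iu\mapsto q_i\,\tau_i\sigma_i^{-1}(u)$). Dictionary order on $\mathcal{A}_r^*$: $u\le_{dict}v$ iff $u\le_{pref}v$, or $u=p\alpha s$, $v=p\beta t$ with letters $\alpha<\beta$. Root group: given $G\le\operatorname{Sym}(m)$ and a prefix code $\widetilde{A}=\{a_0,\dots,a_{n-1}\}$ of $\mathfrak{C}_m$ listed in increasing dictionary order, the root group $\mathcal{R}_G(\widetilde{A})$ is well defined if $\sigma(\widetilde{A})=\widetilde{A}$ for every $\sigma\in G$ (letterwise action); it is then the group of permutations of $\widetilde{A}$ induced by the elements of $G$, regarded as a subgroup of $\operatorname{Sym}(n)$ via the bijection $i\mapsto a_i$ from $\mathcal{A}_n$ to $\widetilde{A}$. The cycle type of $\sigma\in\operatorname{Sym}(n)$ is the multiset of lengths of cycles in its cycle decomposition. Two subgroups $H,H'\le\operatorname{Sym}(n)$ are cyclically isomorphic if there is a group isomorphism $\psi:H\to H'$ with $\sigma$ and $\psi(\sigma)$ of the same cycle type for every $\sigma\in H$. *)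

theory Defs
  imports "HOL-Algebra.Group" "HOL-Combinatorics.Permutations" "HOL-Library.Multiset"
begin

definition cantor :: "nat \<Rightarrow> (nat \<Rightarrow> nat) set" where
  "cantor r = {z. \<forall>i. z i < r}"

definition words :: "nat \<Rightarrow> nat list set" where
  "words r = {u. \<forall>a\<in>set u. a < r}"

definition conc :: "nat list \<Rightarrow> (nat \<Rightarrow> nat) \<Rightarrow> (nat \<Rightarrow> nat)" where
  "conc u w = (\<lambda>i. if i < length u then u ! i else w (i - length u))"

definition pref_inf :: "nat list \<Rightarrow> (nat \<Rightarrow> nat) \<Rightarrow> bool" where
  "pref_inf u z \<longleftrightarrow> (\<forall>i<length u. z i = u ! i)"

definition prefix_code :: "nat \<Rightarrow> nat list set \<Rightarrow> bool" where
  "prefix_code r S \<longleftrightarrow> finite S \<and> S \<subseteq> words r \<and>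
     (\<forall>z\<in>cantor r. \<exists>!s. s \<in> S \<and> pref_inf s z)"

definition perm_subgroup :: "nat \<Rightarrow> (nat \<Rightarrow> nat) set \<Rightarrow> bool" where
  "perm_subgroup r H \<longleftrightarrow> H \<subseteq> {s. s permutes {..<r}} \<and> id \<in> H \<and>
     (\<forall>s\<in>H. \<forall>t\<in>H. s \<circ> t \<in> H) \<and> (\<forall>s\<in>H. Hilbert_Choice.inv s \<in> H)"

(* V_r(H): homeomorphisms of C_r given by tables; as functions on nat => nat
   they are taken to be the identity outside C_r (extensional representation). *)
definition Vset :: "nat \<Rightarrow> (nat \<Rightarrow> nat) set \<Rightarrow> ((nat \<Rightarrow> nat) \<Rightarrow> (nat \<Rightarrow> nat)) set" where
  "Vset r H = {f. (\<forall>z. z \<notin> cantor r \<longrightarrow> f z = z) \<and>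
     (\<exists>(ps :: nat list list) (qs :: nat list list) (ss :: (nat \<Rightarrow> nat) list) (ts :: (nat \<Rightarrow> nat) list).
        length qs = length ps \<and> length ss = length ps \<and> length ts = length ps \<and>
        distinct ps \<and> distinct qs \<and>
        prefix_code r (set ps) \<and> prefix_code r (set qs) \<and>
        set ss \<subseteq> H \<and> set ts \<subseteq> H \<and>
        (\<forall>i<length ps. \<forall>u\<in>cantor r.
            f (conc (ps ! i) ((ss ! i) \<circ> u)) = conc (qs ! i) ((ts ! i) \<circ> u)))}"

definition Vgrp :: "nat \<Rightarrow> (nat \<Rightarrow> nat) set \<Rightarrow> ((nat \<Rightarrow> nat) \<Rightarrow> (nat \<Rightarrow> nat)) monoid" where
  "Vgrp r H = \<lparr>carrier = Vset r H, monoid.mult = (\<circ>), one = id\<rparr>"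

definition dict_le :: "nat list \<Rightarrow> nat list \<Rightarrow> bool" where
  "dict_le u v \<longleftrightarrow> (\<exists>w. v = u @ w) \<or>
     (\<exists>p a b s t. a < b \<and> u = p @ a # s \<and> v = p @ b # t)"

definition dict_lt :: "nat list \<Rightarrow> nat list \<Rightarrow> bool" where
  "dict_lt u v \<longleftrightarrow> dict_le u v \<and> u \<noteq> v"

definition dict_enum :: "nat list set \<Rightarrow> nat list list" where
  "dict_enum A = (THE xs. sorted_wrt dict_lt xs \<and> distinct xs \<and> set xs = A)"

definition root_well_defined :: "(nat \<Rightarrow> nat) set \<Rightarrow> nat list set \<Rightarrow> bool" where
  "root_well_defined G A \<longleftrightarrow> (\<forall>s\<in>G. map s ` A = A)"

definition root_perm :: "nat list set \<Rightarrow> (nat \<Rightarrow> nat) \<Rightarrow> (nat \<Rightarrow> nat)" where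
  "root_perm A s = (\<lambda>i. if i < card A
       then (THE j. j < card A \<and> dict_enum A ! j = map s (dict_enum A ! i)) else i)"

definition root_group :: "(nat \<Rightarrow> nat) set \<Rightarrow> nat list set \<Rightarrow> (nat \<Rightarrow> nat) set" where
  "root_group G A = root_perm A ` G"

definition cycle_of :: "(nat \<Rightarrow> nat) \<Rightarrow> nat \<Rightarrow> nat set" where
  "cycle_of s x = {(s ^^ k) x | k. True}"

definition cycle_type :: "nat \<Rightarrow> (nat \<Rightarrow> nat) \<Rightarrow> nat multiset" where
  "cycle_type n s = image_mset card (mset_set (cycle_of s ` {..<n}))"

definition cyclically_isomorphic :: "nat \<Rightarrow> (nat \<Rightarrow> nat) set \<Rightarrow> (nat \<Rightarrow> nat) set \<Rightarrow> bool" where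
  "cyclically_isomorphic n H H' \<longleftrightarrow> (\<exists>\<psi>. bij_betw \<psi> H H' \<and>
     (\<forall>s\<in>H. \<forall>t\<in>H. \<psi> (s \<circ> t) = \<psi> s \<circ> \<psi> t) \<and>
     (\<forall>s\<in>H. cycle_type n (\<psi> s) = cycle_type n s))"

end

theory Submission
  imports Defs
begin

text \<open>
  Near each point \<open>x\<close> an element \<open>f\<close> of \<open>V\<^sub>n(H)\<close> has the form \<open>pu \<mapsto> q h(u)\<close>, and \<open>h\<close> depends only on
  \<open>f\<close> and \<open>x\<close>. This gives a cocycle \<open>c(f, x) \<in> H\<close>, so \<open>V\<^sub>n(H)\<close> acts on \<open>H \<times> \<CC>\<^sub>n\<close> by
  \<open>(k, x) \<mapsto> (k c(f, x)\<^sup>-\<^sup>1, f x)\<close>. In the coordinates \<open>(k, k(x))\<close> this action only replaces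
  prefixes: \<open>(k, k(p) v)\<close> is sent to \<open>(k', k'(q) v)\<close> where \<open>k' = k h\<^sup>-\<^sup>1\<close>. The prefix code \<open>A\<close> identifies
  \<open>\<CC>\<^sub>n\<close> with \<open>\<CC>\<^sub>m\<close>, and placing the \<open>|H|\<close> copies of \<open>\<CC>\<^sub>n\<close> in disjoint cones of \<open>\<CC>\<^sub>m\<close> embeds \<open>V\<^sub>n(H)\<close>
  in \<open>V\<^sub>m(1) \<le> V\<^sub>m(G)\<close>.
\<close>

unbundle no m_inv_syntax

section \<open>Words and prefixes\<close>

lemma conc_append: "conc (u @ v) z = conc u (conc v z)"
  by (auto simp: conc_def nth_append fun_eq_iff)

lemma comp_conc: "s \<circ> conc u z = conc (map s u) (s \<circ> z)"
  by (auto simp: conc_def fun_eq_iff)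

lemma conc_cancel [simp]: "conc u y = conc u z \<longleftrightarrow> y = z"
proof
  assume eq: "conc u y = conc u z"
  show "y = z"
  proof
    fix i show "y i = z i"
      using fun_cong[OF eq, of "length u + i"] by (simp add: conc_def)
  qed
qed simp

lemma conc_in_cantor: "u \<in> words r \<Longrightarrow> z \<in> cantor r \<Longrightarrow> conc u z \<in> cantor r"
  by (auto simp: conc_def cantor_def words_def)

lemma zero_in_cantor: "0 < r \<Longrightarrow> (\<lambda>_. 0) \<in> cantor r"
  by (simp add: cantor_def)

lemma append_in_words_iff [simp]: "u @ v \<in> words r \<longleftrightarrow> u \<in> words r \<and> v \<in> words r"
  by (auto simp: words_def)

lemma permutes_comp_cantor: "s permutes {..<r} \<Longrightarrow> u \<in> cantor r \<Longrightarrow> s \<circ> u \<in> cantor r"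
  using permutes_in_image[of s "{..<r}"] by (auto simp: cantor_def)

lemma permutes_map_words: "s permutes {..<r} \<Longrightarrow> u \<in> words r \<Longrightarrow> map s u \<in> words r"
  using permutes_in_image[of s "{..<r}"] by (auto simp: words_def)

lemma pref_inf_iff_map: "pref_inf u z \<longleftrightarrow> map z [0..<length u] = u"
  unfolding pref_inf_def by (subst list_eq_iff_nth_eq) simp

lemma pref_inf_map_upt: "pref_inf (map z [0..<N]) z"
  by (simp add: pref_inf_iff_map)

lemma map_upt_in_words: "z \<in> cantor r \<Longrightarrow> map z [0..<N] \<in> words r"
  by (auto simp: words_def cantor_def)

lemma pref_inf_in_words: "pref_inf u z \<Longrightarrow> z \<in> cantor r \<Longrightarrow> u \<in> words r"
  using map_upt_in_words[of z r "length u"] by (simp add: pref_inf_iff_map)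

lemma pref_inf_length_unique: "pref_inf u z \<Longrightarrow> pref_inf v z \<Longrightarrow> length u = length v \<Longrightarrow> u = v"
  by (simp add: pref_inf_iff_map)

lemma pref_inf_conc [simp]: "pref_inf u (conc u z)"
  by (simp add: pref_inf_def conc_def)

lemma pref_inf_append_conc [simp]: "pref_inf (u @ v) (conc u z) \<longleftrightarrow> pref_inf v z"
proof
  assume *: "pref_inf (u @ v) (conc u z)"
  show "pref_inf v z" unfolding pref_inf_def
  proof (intro allI impI)
    fix i assume "i < length v"
    then show "z i = v ! i"
      using *[unfolded pref_inf_def, rule_format, of "length u + i"]
      by (simp add: conc_def nth_append)
  qed
qed (auto simp: pref_inf_def conc_def nth_append)

lemma pref_inf_appendD: "pref_inf (u @ v) z \<Longrightarrow> pref_inf u z"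
  by (fastforce simp: pref_inf_def nth_append)

lemma pref_inf_map_comp: "inj s \<Longrightarrow> pref_inf (map s p) (s \<circ> x) \<longleftrightarrow> pref_inf p x"
  by (auto simp: pref_inf_def inj_eq)

lemma pref_infE:
  assumes "pref_inf u z" "z \<in> cantor r"
  obtains y where "y \<in> cantor r" "z = conc u y"
proof
  show "(\<lambda>i. z (length u + i)) \<in> cantor r" using assms(2) by (simp add: cantor_def)
  show "z = conc u (\<lambda>i. z (length u + i))"
    using assms(1) by (auto simp: conc_def pref_inf_def fun_eq_iff)
qed

lemma pref_inf_comparable:
  assumes "pref_inf u z" "pref_inf v z" "length u \<le> length v"
  obtains w where "v = u @ w"
proof -
  have "pref_inf (take (length u) v) z"
    using pref_inf_appendD[of "take (length u) v" "drop (length u) v"] assms(2) by simp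
  then have "take (length u) v = u"
    using assms by (intro pref_inf_length_unique) auto
  then show thesis using that append_take_drop_id by metis
qed

lemma pref_inf_extend:
  assumes "pref_inf p x" "x \<in> cantor r" "length p \<le> N"
  obtains v where "v \<in> words r" "map x [0..<N] = p @ v"
proof -
  obtain v where v: "map x [0..<N] = p @ v"
    using pref_inf_comparable[OF assms(1) pref_inf_map_upt[of x N]] assms(3) by auto
  moreover have "p @ v \<in> words r" using map_upt_in_words[OF assms(2), of N] v by simp
  ultimately show thesis by (intro that) auto
qed

section \<open>Prefix codes\<close>

lemma prefix_code_finite: "prefix_code r S \<Longrightarrow> finite S"
  and prefix_code_words: "prefix_code r S \<Longrightarrow> s \<in> S \<Longrightarrow> s \<in> words r"
  by (auto simp: prefix_code_def)

lemma prefix_codeE: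
  assumes "prefix_code r S" "z \<in> cantor r"
  obtains s y where "s \<in> S" "y \<in> cantor r" "z = conc s y"
  using assms pref_infE unfolding prefix_code_def by metis

lemma prefix_code_unique:
  assumes "prefix_code r S" "z \<in> cantor r" "s \<in> S" "t \<in> S" "pref_inf s z" "pref_inf t z"
  shows "s = t"
  using assms unfolding prefix_code_def by blast

lemma prefix_codeI:
  assumes "finite S" "S \<subseteq> words r"
    and "\<And>z. z \<in> cantor r \<Longrightarrow> \<exists>s\<in>S. pref_inf s z"
    and "\<And>z s t. z \<in> cantor r \<Longrightarrow> s \<in> S \<Longrightarrow> t \<in> S \<Longrightarrow> pref_inf s z \<Longrightarrow> pref_inf t z \<Longrightarrow> s = t"
  shows "prefix_code r S"
  using assms unfolding prefix_code_def by blast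

lemma prefix_code_imageI:
  assumes "0 < r" "finite I" "\<And>i. i \<in> I \<Longrightarrow> q i \<in> words r"
    and unique: "\<And>z. z \<in> cantor r \<Longrightarrow> \<exists>!i. i \<in> I \<and> pref_inf (q i) z"
  shows "inj_on q I" "prefix_code r (q ` I)"
proof -
  show "inj_on q I"
  proof (rule inj_onI)
    fix i j assume ij: "i \<in> I" "j \<in> I" "q i = q j"
    have "conc (q i) (\<lambda>_. 0) \<in> cantor r"
      using conc_in_cantor zero_in_cantor assms(1,3) ij(1) by blast
    from unique[OF this] ij show "i = j" by (metis pref_inf_conc)
  qed
  show "prefix_code r (q ` I)"
    using assms by (intro prefix_codeI) blast+
qed

lemma prefix_code_Nil: "prefix_code r {[]}"
  by (auto simp: prefix_code_def words_def pref_inf_def)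

lemma prefix_code_uniform: "prefix_code r {v \<in> words r. length v = L}"
proof (rule prefix_codeI)
  have "{v \<in> words r. length v = L} \<subseteq> {v. set v \<subseteq> {..<r} \<and> length v = L}"
    by (auto simp: words_def)
  then show "finite {v \<in> words r. length v = L}"
    by (rule finite_subset) (simp add: finite_lists_length_eq)
next
  fix z assume "z \<in> cantor r"
  then show "\<exists>s\<in>{v \<in> words r. length v = L}. pref_inf s z"
    by (intro bexI[of _ "map z [0..<L]"]) (auto simp: pref_inf_map_upt map_upt_in_words)
qed (auto intro: pref_inf_length_unique)

lemma prefix_code_append:
  assumes D: "prefix_code r D" and S: "\<And>d. d \<in> D \<Longrightarrow> prefix_code r (S d)"
  shows "prefix_code r (\<Union>d\<in>D. (@) d ` S d)"
proof (rule prefix_codeI)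
  show "finite (\<Union>d\<in>D. (@) d ` S d)"
    using D S by (intro finite_UN_I finite_imageI) (auto intro: prefix_code_finite)
  show "(\<Union>d\<in>D. (@) d ` S d) \<subseteq> words r"
    by (auto intro: prefix_code_words[OF D] prefix_code_words[OF S])
next
  fix z assume z: "z \<in> cantor r"
  obtain d y where d: "d \<in> D" "y \<in> cantor r" "z = conc d y" using prefix_codeE[OF D z] .
  obtain s x where s: "s \<in> S d" "y = conc s x" using prefix_codeE[OF S[OF d(1)] d(2)] .
  show "\<exists>t\<in>\<Union>d\<in>D. (@) d ` S d. pref_inf t z"
    using d s by (intro bexI[of _ "d @ s"]) auto
next
  fix z t t' assume z: "z \<in> cantor r" and pref: "pref_inf t z" "pref_inf t' z"
  assume "t \<in> (\<Union>d\<in>D. (@) d ` S d)" "t' \<in> (\<Union>d\<in>D. (@) d ` S d)"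
  then obtain d s d' s' where t: "d \<in> D" "s \<in> S d" "t = d @ s"
    and t': "d' \<in> D" "s' \<in> S d'" "t' = d' @ s'"
    by blast
  have d: "d' = d"
    using prefix_code_unique[OF D z t'(1) t(1)] pref t(3) t'(3) pref_inf_appendD by blast
  obtain y where y: "y \<in> cantor r" "z = conc d y"
    using pref_infE[OF pref_inf_appendD z] pref(1) t(3) by blast
  have "s = s'"
    using prefix_code_unique[OF S[OF t(1)] y(1)] t t' d pref y(2) by simp
  then show "t = t'" using t t' d by simp
qed

lemma prefix_code_transport:
  assumes S: "prefix_code n S" and surj: "\<phi> ` cantor n = cantor m"
    and words: "\<And>p. p \<in> words n \<Longrightarrow> g p \<in> words m"
    and pref: "\<And>p x. p \<in> words n \<Longrightarrow> x \<in> cantor n \<Longrightarrow> pref_inf (g p) (\<phi> x) \<longleftrightarrow> pref_inf p x"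
  shows "prefix_code m (g ` S)"
proof (rule prefix_codeI)
  show "finite (g ` S)" using S by (simp add: prefix_code_finite)
  show "g ` S \<subseteq> words m" using S words prefix_code_words by blast
next
  fix z assume "z \<in> cantor m"
  then obtain x where x: "x \<in> cantor n" "z = \<phi> x" using surj by blast
  then show "\<exists>s\<in>g ` S. pref_inf s z"
    using prefix_codeE[OF S x(1)] prefix_code_words[OF S] pref by (metis imageI pref_inf_conc)
next
  fix z s t assume "z \<in> cantor m" "s \<in> g ` S" "t \<in> g ` S" "pref_inf s z" "pref_inf t z"
  moreover from this obtain x where "x \<in> cantor n" "z = \<phi> x" using surj by blast
  ultimately show "s = t" using prefix_code_unique[OF S] prefix_code_words[OF S] pref by blast
qed

lemma prefix_code_Nil_notin:
  assumes "prefix_code r A" "2 \<le> card A"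
  shows "[] \<notin> A"
proof
  assume Nil: "[] \<in> A"
  have "A \<subseteq> {[]}"
  proof (rule subsetI, rule ccontr)
    fix t assume t: "t \<in> A" "t \<notin> {[]}"
    then have "hd t < r" using prefix_code_words[OF assms(1)] by (auto simp: words_def)
    then have "conc t (\<lambda>_. 0) \<in> cantor r"
      using conc_in_cantor[OF prefix_code_words[OF assms(1) t(1)]] zero_in_cantor by simp
    moreover have "pref_inf [] (conc t (\<lambda>_. 0))" by (simp add: pref_inf_def)
    ultimately have "t = []"
      using prefix_code_unique[OF assms(1) _ t(1) Nil] by simp
    then show False using t(2) by simp
  qed
  from card_mono[OF _ this] assms(2) show False by simp
qed

section \<open>Permutation groups and actions on cones\<close>

lemma perm_subgroup_permutes: "perm_subgroup r H \<Longrightarrow> h \<in> H \<Longrightarrow> h permutes {..<r}"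
  and perm_subgroup_id: "perm_subgroup r H \<Longrightarrow> id \<in> H"
  and perm_subgroup_comp: "perm_subgroup r H \<Longrightarrow> h \<in> H \<Longrightarrow> k \<in> H \<Longrightarrow> h \<circ> k \<in> H"
  and perm_subgroup_inv: "perm_subgroup r H \<Longrightarrow> h \<in> H \<Longrightarrow> inv h \<in> H"
  by (auto simp: perm_subgroup_def)

lemma perm_subgroup_finite: "perm_subgroup r H \<Longrightarrow> finite H"
  using finite_permutations[of "{..<r}"] by (auto simp: perm_subgroup_def intro: finite_subset)

lemma permutes_comp_inv_cancel:
  assumes "h permutes S"
  shows "k \<circ> inv h \<circ> h = k" "k \<circ> h \<circ> inv h = k" "h \<circ> (inv h \<circ> k) = k"
  using permutes_inv_o[OF assms] by (simp_all add: comp_assoc) (simp flip: comp_assoc)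

lemma permutes_comp_cantor_image:
  assumes "s permutes {..<r}"
  shows "(\<circ>) s ` cantor r = cantor r"
proof (intro equalityI subsetI)
  fix y assume "y \<in> cantor r"
  then have "inv s \<circ> y \<in> cantor r" by (rule permutes_comp_cantor[OF permutes_inv[OF assms]])
  moreover have "y = s \<circ> (inv s \<circ> y)" using permutes_comp_inv_cancel(3)[OF assms] by simp
  ultimately show "y \<in> (\<circ>) s ` cantor r" by (metis imageI)
qed (use permutes_comp_cantor[OF assms] in blast)

definition acts_on_cone ::
  "nat \<Rightarrow> ((nat \<Rightarrow> nat) \<Rightarrow> nat \<Rightarrow> nat) \<Rightarrow> nat list \<Rightarrow> nat list \<Rightarrow> (nat \<Rightarrow> nat) \<Rightarrow> bool" where
  "acts_on_cone r f p q h \<longleftrightarrow> (\<forall>u\<in>cantor r. f (conc p u) = conc q (h \<circ> u))"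

lemma acts_on_coneD: "acts_on_cone r f p q h \<Longrightarrow> u \<in> cantor r \<Longrightarrow> f (conc p u) = conc q (h \<circ> u)"
  by (simp add: acts_on_cone_def)

lemma acts_on_cone_pref_inf:
  assumes "acts_on_cone r f p q h" "pref_inf p x" "x \<in> cantor r"
  shows "pref_inf q (f x)"
  using pref_infE[OF assms(2,3)] acts_on_coneD[OF assms(1)] by (metis pref_inf_conc)

lemma acts_on_cone_append:
  assumes "acts_on_cone r f p q h" "v \<in> words r"
  shows "acts_on_cone r f (p @ v) (q @ map h v) h"
  using assms conc_in_cantor by (simp add: acts_on_cone_def conc_append comp_conc)

lemma acts_on_cone_comp:
  assumes "acts_on_cone r g p q h" "acts_on_cone r f q q' h'" "h permutes {..<r}"
  shows "acts_on_cone r (f \<circ> g) p q' (h' \<circ> h)"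
  using assms permutes_comp_cantor by (simp add: acts_on_cone_def comp_assoc)

lemma acts_on_cone_comp_inv:
  assumes "s permutes {..<r}"
    and "\<And>u. u \<in> cantor r \<Longrightarrow> f (conc p (s \<circ> u)) = conc q (t \<circ> u)"
  shows "acts_on_cone r f p q (t \<circ> inv s)"
  unfolding acts_on_cone_def
proof
  fix u assume "u \<in> cantor r"
  then show "f (conc p u) = conc q ((t \<circ> inv s) \<circ> u)"
    using assms(2)[OF permutes_comp_cantor[OF permutes_inv[OF assms(1)]]]
      permutes_comp_inv_cancel(3)[OF assms(1)]
    by (simp add: comp_assoc)
qed

lemma acts_on_cone_preimage:
  assumes "acts_on_cone r f p q h" "h permutes {..<r}" "p \<in> words r" "z \<in> cantor r" "pref_inf q z"
  obtains x where "x \<in> cantor r" "pref_inf p x" "f x = z"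
proof -
  obtain y where y: "y \<in> cantor r" "z = conc q y" using pref_infE[OF assms(5,4)] .
  have u: "inv h \<circ> y \<in> cantor r"
    using permutes_comp_cantor[OF permutes_inv[OF assms(2)] y(1)] .
  have "f (conc p (inv h \<circ> y)) = z"
    using acts_on_coneD[OF assms(1) u] permutes_comp_inv_cancel(3)[OF assms(2)] y(2) by simp
  then show thesis
    using that conc_in_cantor[OF assms(3) u] pref_inf_conc by blast
qed

lemma bij_betw_of_cone_actions:
  assumes P: "prefix_code r P" and Q: "inj_on Q P" "prefix_code r (Q ` P)"
    and h: "\<And>p. p \<in> P \<Longrightarrow> h p permutes {..<r}"
    and f: "\<And>p. p \<in> P \<Longrightarrow> acts_on_cone r f p (Q p) (h p)"
  shows "bij_betw f (cantor r) (cantor r)"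
proof (rule bij_betw_imageI)
  have maps: "f x \<in> cantor r" if x: "x \<in> cantor r" for x
  proof -
    obtain p u where p: "p \<in> P" "u \<in> cantor r" "x = conc p u" using prefix_codeE[OF P x] .
    then have "f x = conc (Q p) (h p \<circ> u)" using acts_on_coneD[OF f] by blast
    then show ?thesis
      using p prefix_code_words[OF Q(2)] by (simp add: conc_in_cantor permutes_comp_cantor[OF h])
  qed
  show "f ` cantor r = cantor r"
  proof (intro equalityI subsetI)
    fix z assume z: "z \<in> cantor r"
    obtain p y where p: "p \<in> P" "z = conc (Q p) y" using prefix_codeE[OF Q(2) z] by blast
    have "pref_inf (Q p) z" using p(2) by simp
    then obtain x where "x \<in> cantor r" "f x = z"
      by (rule acts_on_cone_preimage[OF f[OF p(1)] h[OF p(1)] prefix_code_words[OF P p(1)] z])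
    then show "z \<in> f ` cantor r" by blast
  qed (use maps in blast)
  show "inj_on f (cantor r)"
  proof (rule inj_onI)
    fix x y assume x: "x \<in> cantor r" and y: "y \<in> cantor r" and eq: "f x = f y"
    obtain p u where p: "p \<in> P" "u \<in> cantor r" "x = conc p u" using prefix_codeE[OF P x] .
    obtain q v where q: "q \<in> P" "v \<in> cantor r" "y = conc q v" using prefix_codeE[OF P y] .
    have fx: "f x = conc (Q p) (h p \<circ> u)" using acts_on_coneD[OF f[OF p(1)] p(2)] p(3) by simp
    have fy: "f y = conc (Q q) (h q \<circ> v)" using acts_on_coneD[OF f[OF q(1)] q(2)] q(3) by simp
    have "Q p = Q q"
      using prefix_code_unique[OF Q(2) maps[OF x]] p(1) q(1) fx fy eq
      by (metis imageI pref_inf_conc)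
    then have "q = p" using Q(1) p(1) q(1) by (simp add: inj_on_eq_iff)
    then have "h p \<circ> u = h p \<circ> v" using fx fy eq by simp
    then have "u = v" using permutes_inj[OF h[OF p(1)]] by (simp add: fun_eq_iff inj_eq)
    then show "x = y" using p(3) q(3) \<open>q = p\<close> by simp
  qed
qed

lemma prefix_code_image_of_cone_actions:
  assumes "0 < r" and bij: "bij_betw f (cantor r) (cantor r)" and P: "prefix_code r P"
    and Q: "\<And>p. p \<in> P \<Longrightarrow> Q p \<in> words r" and h: "\<And>p. p \<in> P \<Longrightarrow> h p permutes {..<r}"
    and f: "\<And>p. p \<in> P \<Longrightarrow> acts_on_cone r f p (Q p) (h p)"
  shows "inj_on Q P" "prefix_code r (Q ` P)"
proof -
  have "\<exists>!p. p \<in> P \<and> pref_inf (Q p) z" if z: "z \<in> cantor r" for z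
  proof -
    have "z \<in> f ` cantor r" using bij_betw_imp_surj_on[OF bij] z by simp
    then obtain x where x: "x \<in> cantor r" "f x = z" by blast
    obtain p where p: "p \<in> P" "pref_inf p x" using prefix_codeE[OF P x(1)] by (metis pref_inf_conc)
    show ?thesis
    proof (rule ex1I[of _ p])
      show "p \<in> P \<and> pref_inf (Q p) z"
        using acts_on_cone_pref_inf[OF f[OF p(1)] p(2) x(1)] p(1) x(2) by simp
      fix q assume q: "q \<in> P \<and> pref_inf (Q q) z"
      then obtain y where y: "y \<in> cantor r" "pref_inf q y" "f y = z"
        using acts_on_cone_preimage[OF f h prefix_code_words[OF P] z] by blast
      then have "y = x" using bij x by (auto simp: bij_betw_def inj_on_def)
      then show "q = p" using prefix_code_unique[OF P x(1)] p q y(2) by blast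
    qed
  qed
  then show "inj_on Q P" "prefix_code r (Q ` P)"
    using prefix_code_imageI[where q = Q, OF assms(1) prefix_code_finite[OF P] Q] by blast+
qed

section \<open>Elements of symmetric Thompson groups\<close>

lemma Vset_outside: "f \<in> Vset r H \<Longrightarrow> z \<notin> cantor r \<Longrightarrow> f z = z"
  by (simp add: Vset_def)

lemma Vset_cone_actions:
  assumes "f \<in> Vset r H" and H: "perm_subgroup r H"
  obtains P Q h where "prefix_code r P" "inj_on Q P" "prefix_code r (Q ` P)"
    "\<And>p. p \<in> P \<Longrightarrow> h p \<in> H" "\<And>p. p \<in> P \<Longrightarrow> acts_on_cone r f p (Q p) (h p)"
proof -
  from assms(1) obtain ps qs ss ts where len: "length qs = length ps" "length ss = length ps"
      "length ts = length ps"
    and dist: "distinct ps" "distinct qs"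
    and codes: "prefix_code r (set ps)" "prefix_code r (set qs)"
    and perms: "set ss \<subseteq> H" "set ts \<subseteq> H"
    and f: "\<And>i u. i < length ps \<Longrightarrow> u \<in> cantor r \<Longrightarrow>
      f (conc (ps ! i) ((ss ! i) \<circ> u)) = conc (qs ! i) ((ts ! i) \<circ> u)"
    unfolding Vset_def by blast
  have in_H: "ss ! i \<in> H" "ts ! i \<in> H" if "i < length ps" for i
    using perms len that by (auto simp: subset_iff)
  define index where "index = inv_into {..<length ps} ((!) ps)"
  have index: "index (ps ! i) = i" if "i < length ps" for i
    unfolding index_def using that by (intro inv_into_f_f inj_on_nth dist(1)) auto
  have set_ps: "set ps = (!) ps ` {..<length ps}" and set_qs: "set qs = (!) qs ` {..<length ps}"
    using len(1) by (auto simp: set_conv_nth)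
  show thesis
  proof (rule that[of "set ps" "\<lambda>p. qs ! index p" "\<lambda>p. ts ! index p \<circ> inv (ss ! index p)"])
    have "inj_on ((!) qs) {..<length ps}" using dist(2) len(1) by (intro inj_on_nth) auto
    then have "inj_on ((\<lambda>p. qs ! index p) \<circ> (!) ps) {..<length ps}"
      by (rule inj_on_cong[THEN iffD1, rotated]) (simp add: index)
    then show "inj_on (\<lambda>p. qs ! index p) (set ps)"
      unfolding set_ps by (rule inj_on_imageI)
    have "(\<lambda>p. qs ! index p) ` set ps = set qs"
      unfolding set_ps set_qs image_image by (rule image_cong) (simp_all add: index)
    then show "prefix_code r ((\<lambda>p. qs ! index p) ` set ps)" using codes(2) by simp
  next
    fix p assume "p \<in> set ps"
    then obtain i where i: "i < length ps" "p = ps ! i" unfolding set_ps by blast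
    show "ts ! index p \<circ> inv (ss ! index p) \<in> H"
      using i index in_H by (simp add: perm_subgroup_comp[OF H] perm_subgroup_inv[OF H])
    show "acts_on_cone r f p (qs ! index p) (ts ! index p \<circ> inv (ss ! index p))"
      using acts_on_cone_comp_inv[OF perm_subgroup_permutes[OF H in_H(1)] f] i index by simp
  qed (rule codes(1))
qed

lemma Vset_bij_betw:
  assumes "f \<in> Vset r H" "perm_subgroup r H"
  shows "bij_betw f (cantor r) (cantor r)"
  using Vset_cone_actions[OF assms] bij_betw_of_cone_actions perm_subgroup_permutes[OF assms(2)]
  by metis

lemma Vset_maps_cantor:
  "f \<in> Vset r H \<Longrightarrow> perm_subgroup r H \<Longrightarrow> x \<in> cantor r \<Longrightarrow> f x \<in> cantor r"
  using Vset_bij_betw bij_betw_apply by metis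

lemma VsetI:
  assumes H: "perm_subgroup r H" and "0 < r"
    and outside: "\<And>z. z \<notin> cantor r \<Longrightarrow> f z = z"
    and bij: "bij_betw f (cantor r) (cantor r)"
    and P: "prefix_code r P"
    and act: "\<And>p. p \<in> P \<Longrightarrow> \<exists>q\<in>words r. \<exists>h\<in>H. acts_on_cone r f p q h"
  shows "f \<in> Vset r H"
proof -
  obtain Q h where Q: "\<And>p. p \<in> P \<Longrightarrow> Q p \<in> words r" and h: "\<And>p. p \<in> P \<Longrightarrow> h p \<in> H"
    and Qh: "\<And>p. p \<in> P \<Longrightarrow> acts_on_cone r f p (Q p) (h p)"
    using act by metis
  have image: "inj_on Q P" "prefix_code r (Q ` P)"
    using prefix_code_image_of_cone_actions[OF assms(2) bij P Q perm_subgroup_permutes[OF H h] Qh]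
    by blast+
  obtain ps where ps: "set ps = P" "distinct ps"
    using finite_distinct_list[OF prefix_code_finite[OF P]] by blast
  show ?thesis
    unfolding Vset_def
  proof (intro CollectI conjI allI impI exI)
    show "prefix_code r (set ps)" "prefix_code r (set (map Q ps))"
      "distinct ps" "distinct (map Q ps)"
      using P image ps by (auto simp: distinct_map)
    show "set (map (\<lambda>_. id) ps) \<subseteq> H" "set (map h ps) \<subseteq> H"
      using perm_subgroup_id[OF H] h ps by auto
    show "\<forall>u\<in>cantor r. f (conc (ps ! i) (map (\<lambda>_. id) ps ! i \<circ> u)) =
        conc (map Q ps ! i) (map h ps ! i \<circ> u)"
      if "i < length ps" for i
      using that acts_on_coneD[OF Qh] ps(1) by auto
  qed (use outside in simp_all)
qed

section \<open>The local permutation cocycle\<close>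

definition local_perm :: "nat \<Rightarrow> ((nat \<Rightarrow> nat) \<Rightarrow> nat \<Rightarrow> nat) \<Rightarrow> (nat \<Rightarrow> nat) \<Rightarrow> nat \<Rightarrow> nat" where
  "local_perm r f x =
     (THE h. h permutes {..<r} \<and> (\<exists>p q. pref_inf p x \<and> acts_on_cone r f p q h))"

lemma conc_permutes_length_le:
  assumes "2 \<le> r" "h permutes {..<r}"
    and eq: "\<And>u. u \<in> cantor r \<Longrightarrow> conc q (h \<circ> u) = conc q' (h' \<circ> u)"
  shows "length q' \<le> length q"
proof (rule ccontr)
  assume "\<not> length q' \<le> length q"
  then have "h a = q' ! length q" if "a < r" for a
    using fun_cong[OF eq[of "\<lambda>_. a"], of "length q"] that by (simp add: conc_def cantor_def)
  from this[of 0] this[of 1] have "h 0 = h 1" using assms(1) by simp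
  then show False using permutes_inj[OF assms(2)] by (metis injD zero_neq_one)
qed

lemma conc_permutes_unique:
  assumes "2 \<le> r" "h permutes {..<r}" "h' permutes {..<r}"
    and eq: "\<And>u. u \<in> cantor r \<Longrightarrow> conc q (h \<circ> u) = conc q' (h' \<circ> u)"
  shows "h = h'"
proof
  fix a
  have len: "length q = length q'"
    using conc_permutes_length_le[OF assms(1,2) eq]
      conc_permutes_length_le[OF assms(1,3) eq[symmetric]]
    by simp
  show "h a = h' a"
  proof (cases "a < r")
    case True
    then show ?thesis
      using fun_cong[OF eq[of "\<lambda>_. a"], of "length q"] len by (simp add: conc_def cantor_def)
  next
    case False
    then show ?thesis using assms(2,3) by (simp add: permutes_def)
  qed
qed

lemma acts_on_cone_unique:
  assumes "2 \<le> r" "x \<in> cantor r" "h permutes {..<r}" "h' permutes {..<r}"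
    and p: "pref_inf p x" "acts_on_cone r f p q h"
    and p': "pref_inf p' x" "acts_on_cone r f p' q' h'"
  shows "h = h'"
proof -
  define N where "N = length p + length p'"
  obtain v where v: "v \<in> words r" "map x [0..<N] = p @ v"
    using pref_inf_extend[OF p(1) assms(2), of N] by (auto simp: N_def)
  obtain v' where v': "v' \<in> words r" "map x [0..<N] = p' @ v'"
    using pref_inf_extend[OF p'(1) assms(2), of N] by (auto simp: N_def)
  show ?thesis
  proof (rule conc_permutes_unique[OF assms(1,3,4)])
    fix u assume "u \<in> cantor r"
    then show "conc (q @ map h v) (h \<circ> u) = conc (q' @ map h' v') (h' \<circ> u)"
      using acts_on_cone_append[OF p(2) v(1)] acts_on_cone_append[OF p'(2) v'(1)] v(2) v'(2)
      by (metis acts_on_coneD)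
  qed
qed

lemma local_perm_eq:
  assumes "2 \<le> r" "x \<in> cantor r" "h permutes {..<r}" "pref_inf p x" "acts_on_cone r f p q h"
  shows "local_perm r f x = h"
  unfolding local_perm_def
  by (rule the_equality) (use assms acts_on_cone_unique in blast)+

lemma Vset_local_cone_action:
  assumes "f \<in> Vset r H" "perm_subgroup r H" "x \<in> cantor r"
  obtains p q h where "pref_inf p x" "h \<in> H" "acts_on_cone r f p q h"
  using Vset_cone_actions[OF assms(1,2)] prefix_codeE[OF _ assms(3)] by (metis pref_inf_conc)

lemma local_perm_in:
  assumes "2 \<le> r" "perm_subgroup r H" "f \<in> Vset r H" "x \<in> cantor r"
  shows "local_perm r f x \<in> H"
proof -
  obtain p q h where h: "pref_inf p x" "h \<in> H" "acts_on_cone r f p q h"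
    using Vset_local_cone_action[OF assms(3,2,4)] .
  then show ?thesis
    using local_perm_eq[OF assms(1,4) perm_subgroup_permutes[OF assms(2)]] by simp
qed

lemma local_perm_comp:
  assumes r: "2 \<le> r" and H: "perm_subgroup r H"
    and f: "f \<in> Vset r H" and g: "g \<in> Vset r H" and x: "x \<in> cantor r"
  shows "local_perm r (f \<circ> g) x = local_perm r f (g x) \<circ> local_perm r g x"
proof -
  have gx: "g x \<in> cantor r" using Vset_maps_cantor[OF g H x] .
  obtain p q h where p: "pref_inf p x" "h \<in> H" "acts_on_cone r g p q h"
    using Vset_local_cone_action[OF g H x] .
  obtain p' q' h' where p': "pref_inf p' (g x)" "h' \<in> H" "acts_on_cone r f p' q' h'"
    using Vset_local_cone_action[OF f H gx] .
  have h: "h permutes {..<r}" and h': "h' permutes {..<r}"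
    using perm_subgroup_permutes[OF H] p(2) p'(2) by auto
  obtain v where v: "v \<in> words r" "map x [0..<length p + length p'] = p @ v"
    using pref_inf_extend[OF p(1) x] by (metis le_add1)
  have pv: "pref_inf (p @ v) x" using pref_inf_map_upt v(2) by metis
  have g_act: "acts_on_cone r g (p @ v) (q @ map h v) h" using acts_on_cone_append[OF p(3) v(1)] .
  have qv: "pref_inf (q @ map h v) (g x)" using acts_on_cone_pref_inf[OF g_act pv x] .
  have "length v = length p'" using arg_cong[OF v(2), of length] by simp
  then obtain v' where v': "q @ map h v = p' @ v'"
    using pref_inf_comparable[OF p'(1) qv] by auto
  then have "v' \<in> words r" using pref_inf_in_words[OF qv gx] by simp
  then have "acts_on_cone r f (q @ map h v) (q' @ map h' v') h'"
    using acts_on_cone_append[OF p'(3)] v' by simp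
  then have "local_perm r (f \<circ> g) x = h' \<circ> h"
    using local_perm_eq[OF r x permutes_compose[OF h h'] pv] acts_on_cone_comp[OF g_act _ h]
    by blast
  then show ?thesis
    using local_perm_eq[OF r x h p(1,3)] local_perm_eq[OF r gx h' p'(1,3)] by simp
qed

fun skew_product :: "nat \<Rightarrow> ((nat \<Rightarrow> nat) \<Rightarrow> nat \<Rightarrow> nat) \<Rightarrow>
    (nat \<Rightarrow> nat) \<times> (nat \<Rightarrow> nat) \<Rightarrow> (nat \<Rightarrow> nat) \<times> (nat \<Rightarrow> nat)" where
  "skew_product r f (k, x) = (k \<circ> inv (local_perm r f x), f x)"

lemma skew_product_comp:
  assumes "2 \<le> r" "perm_subgroup r H" "f \<in> Vset r H" "g \<in> Vset r H" "x \<in> cantor r"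
  shows "skew_product r (f \<circ> g) (k, x) = skew_product r f (skew_product r g (k, x))"
proof -
  have "local_perm r f (g x) \<in> H" "local_perm r g x \<in> H"
    using local_perm_in[OF assms(1,2)] Vset_maps_cantor[OF assms(4,2)] assms(3-5) by blast+
  then have "bij (local_perm r f (g x))" "bij (local_perm r g x)"
    using permutes_bij perm_subgroup_permutes[OF assms(2)] by blast+
  then have "inv (local_perm r (f \<circ> g) x) = inv (local_perm r g x) \<circ> inv (local_perm r f (g x))"
    by (simp add: local_perm_comp[OF assms] o_inv_distrib)
  then show ?thesis by (simp add: comp_assoc)
qed

lemma bij_betw_skew_product:
  assumes r: "2 \<le> r" and H: "perm_subgroup r H" and f: "f \<in> Vset r H"
  shows "bij_betw (skew_product r f) (H \<times> cantor r) (H \<times> cantor r)"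
proof (rule bij_betw_imageI)
  note bij = Vset_bij_betw[OF f H]
  note perm_in = local_perm_in[OF r H f]
  note cancel = permutes_comp_inv_cancel[OF perm_subgroup_permutes[OF H perm_in]]
  show "inj_on (skew_product r f) (H \<times> cantor r)"
  proof (rule inj_onI, clarify)
    fix k k' x x' assume x: "x \<in> cantor r" "x' \<in> cantor r"
      and eq: "skew_product r f (k, x) = skew_product r f (k', x')"
    have "x = x'" using inj_onD[OF bij_betw_imp_inj_on[OF bij] _ x] eq by simp
    then have "k \<circ> inv (local_perm r f x) = k' \<circ> inv (local_perm r f x)" using eq by simp
    then have "k = k'" using cancel(1)[OF x(1)] by metis
    with \<open>x = x'\<close> show "k = k' \<and> x = x'" by simp
  qed
  show "skew_product r f ` (H \<times> cantor r) = H \<times> cantor r"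
  proof (intro equalityI subsetI)
    fix y assume "y \<in> H \<times> cantor r"
    then have "y \<in> H \<times> f ` cantor r" using bij_betw_imp_surj_on[OF bij] by simp
    then obtain k x where y: "k \<in> H" "x \<in> cantor r" "y = (k, f x)" by blast
    then have "y = skew_product r f (k \<circ> local_perm r f x, x)" using cancel(2) by simp
    then show "y \<in> skew_product r f ` (H \<times> cantor r)"
      using y perm_in perm_subgroup_comp[OF H] by blast
  next
    fix y assume "y \<in> skew_product r f ` (H \<times> cantor r)"
    then obtain k x where "k \<in> H" "x \<in> cantor r" "y = (k \<circ> inv (local_perm r f x), f x)"
      by auto
    then show "y \<in> H \<times> cantor r"
      using perm_subgroup_comp[OF H _ perm_subgroup_inv[OF H perm_in]] bij_betw_apply[OF bij]
      by blast
  qed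
qed

section \<open>Substitution along a prefix code\<close>

definition subst_word :: "('a \<Rightarrow> 'b list) \<Rightarrow> 'a list \<Rightarrow> 'b list" where
  "subst_word e p = concat (map e p)"

lemma subst_word_Nil [simp]: "subst_word e [] = []"
  and subst_word_Cons [simp]: "subst_word e (a # p) = e a @ subst_word e p"
  and subst_word_append [simp]: "subst_word e (p @ q) = subst_word e p @ subst_word e q"
  by (simp_all add: subst_word_def)

text \<open>The index \<open>i\<close> is in range as soon as \<open>e\<close> is nonempty on the letters of \<open>x\<close>.\<close>

definition subst_inf :: "(nat \<Rightarrow> nat list) \<Rightarrow> (nat \<Rightarrow> nat) \<Rightarrow> nat \<Rightarrow> nat" where
  "subst_inf e x i = subst_word e (map x [0..<Suc i]) ! i"

lemma map_conc_upt:
  assumes "length p \<le> N"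
  shows "map (conc p x) [0..<N] = p @ map x [0..<N - length p]"
  using assms by (intro nth_equalityI) (auto simp: conc_def nth_append)

locale code_substitution =
  fixes m n :: nat and e :: "nat \<Rightarrow> nat list" and A :: "nat list set"
  assumes code: "prefix_code m A" and enum: "bij_betw e {..<n} A" and n_ge2: "2 \<le> n"
begin

lemma image_in_code: "a < n \<Longrightarrow> e a \<in> A"
  using bij_betw_apply[OF enum] by simp

lemma image_nonempty: "a < n \<Longrightarrow> e a \<noteq> []"
  using prefix_code_Nil_notin[OF code] image_in_code bij_betw_same_card[OF enum] n_ge2 by fastforce

lemma subst_word_in: "p \<in> words n \<Longrightarrow> subst_word e p \<in> words m"
  using prefix_code_words[OF code image_in_code] by (induction p) (auto simp: words_def)

lemma length_le_subst_word: "p \<in> words n \<Longrightarrow> length p \<le> length (subst_word e p)"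
proof (induction p)
  case (Cons a p)
  then have "e a \<noteq> []" using image_nonempty by (simp add: words_def)
  moreover have "p \<in> words n" using Cons.prems by (simp add: words_def)
  ultimately show ?case using Cons.IH by (cases "e a") auto
qed simp

lemma less_length_subst_word_upt:
  assumes "x \<in> cantor n" "i < N"
  shows "i < length (subst_word e (map x [0..<N]))"
  using length_le_subst_word[OF map_upt_in_words[OF assms(1), of N]] assms(2) by simp

lemma pref_inf_subst_inf:
  assumes "x \<in> cantor n"
  shows "pref_inf (subst_word e (map x [0..<N])) (subst_inf e x)"
  unfolding pref_inf_def
proof (intro allI impI)
  fix i assume i: "i < length (subst_word e (map x [0..<N]))"
  have i': "i < length (subst_word e (map x [0..<Suc i]))"
    using less_length_subst_word_upt[OF assms] by blast
  show "subst_inf e x i = subst_word e (map x [0..<N]) ! i"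
  proof (cases "N \<le> Suc i")
    case True
    then have "[0..<Suc i] = [0..<N] @ [N..<Suc i]" by (metis le_iff_add upt_add_eq_append zero_le)
    then show ?thesis unfolding subst_inf_def using i by (simp add: nth_append del: upt_Suc)
  next
    case False
    then have "[0..<N] = [0..<Suc i] @ [Suc i..<N]"
      by (metis le_iff_add nat_le_linear upt_add_eq_append zero_le)
    then show ?thesis unfolding subst_inf_def using i' by (simp add: nth_append del: upt_Suc)
  qed
qed

lemma subst_inf_eqI:
  assumes "x \<in> cantor n" and pref: "\<And>N. K \<le> N \<Longrightarrow> pref_inf (subst_word e (map x [0..<N])) z"
  shows "subst_inf e x = z"
proof
  fix i
  have "i < length (subst_word e (map x [0..<K + Suc i]))"
    using less_length_subst_word_upt[OF assms(1)] by (simp del: upt_Suc)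
  then show "subst_inf e x i = z i"
    using pref[of "K + Suc i"] pref_inf_subst_inf[OF assms(1), of "K + Suc i"]
    unfolding pref_inf_def by simp
qed

lemma subst_inf_in:
  assumes "x \<in> cantor n"
  shows "subst_inf e x \<in> cantor m"
proof -
  have "subst_inf e x i < m" for i
    using subst_word_in[OF map_upt_in_words[OF assms, of "Suc i"]]
      nth_mem[OF less_length_subst_word_upt[OF assms lessI[of i]]]
    unfolding subst_inf_def words_def by blast
  then show ?thesis by (simp add: cantor_def)
qed

lemma subst_inf_conc:
  assumes "p \<in> words n" "x \<in> cantor n"
  shows "subst_inf e (conc p x) = conc (subst_word e p) (subst_inf e x)"
proof (rule subst_inf_eqI[of _ "length p"])
  show "conc p x \<in> cantor n" using conc_in_cantor[OF assms] .
  show "pref_inf (subst_word e (map (conc p x) [0..<N])) (conc (subst_word e p) (subst_inf e x))"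
    if "length p \<le> N" for N
    using that pref_inf_subst_inf[OF assms(2)] by (simp add: map_conc_upt)
qed

lemma subst_word_unique:
  assumes "length p = length q" "p \<in> words n" "q \<in> words n" "z \<in> cantor m"
    "pref_inf (subst_word e p) z" "pref_inf (subst_word e q) z"
  shows "p = q"
  using assms
proof (induction p q arbitrary: z rule: list_induct2)
  case (Cons a p b q)
  have ab: "a < n" "b < n"
    and pref: "pref_inf (e a @ subst_word e p) z" "pref_inf (e b @ subst_word e q) z"
    using Cons.prems by (auto simp: words_def)
  have "e a = e b"
    using prefix_code_unique[OF code Cons.prems(3)] ab image_in_code pref pref_inf_appendD by blast
  then have "a = b" using enum ab by (auto simp: bij_betw_def inj_on_def)
  obtain y where y: "y \<in> cantor m" "z = conc (e a) y"
    using pref_infE[OF pref_inf_appendD[OF pref(1)] Cons.prems(3)] .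
  have "p = q"
    using Cons.IH[OF _ _ y(1)] Cons.prems(1,2) pref y(2) \<open>a = b\<close> by (simp add: words_def)
  with \<open>a = b\<close> show ?case by simp
qed simp

lemma subst_word_exists:
  assumes "z \<in> cantor m"
  shows "\<exists>p\<in>words n. length p = N \<and> pref_inf (subst_word e p) z"
  using assms
proof (induction N arbitrary: z)
  case 0
  show ?case by (intro bexI[of _ "[]"]) (auto simp: words_def pref_inf_def)
next
  case (Suc N)
  obtain s y where s: "s \<in> A" "y \<in> cantor m" "z = conc s y" using prefix_codeE[OF code Suc.prems] .
  obtain a where a: "a < n" "e a = s" using s(1) enum by (auto simp: bij_betw_def)
  obtain p where "p \<in> words n" "length p = N" "pref_inf (subst_word e p) y"
    using Suc.IH[OF s(2)] by blast
  then show ?case using a s(3) by (intro bexI[of _ "a # p"]) (auto simp: words_def)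
qed

lemma subst_inf_inj: "inj_on (subst_inf e) (cantor n)"
proof (rule inj_onI)
  fix x y assume x: "x \<in> cantor n" and y: "y \<in> cantor n" and eq: "subst_inf e x = subst_inf e y"
  show "x = y"
  proof
    fix i
    have "map x [0..<Suc i] = map y [0..<Suc i]"
      using subst_word_unique[OF _ map_upt_in_words[OF x] map_upt_in_words[OF y] subst_inf_in[OF x]]
        pref_inf_subst_inf[OF x] pref_inf_subst_inf[OF y] eq by (simp del: upt_Suc)
    then show "x i = y i" by simp
  qed
qed

lemma subst_inf_surj: "subst_inf e ` cantor n = cantor m"
proof (intro equalityI subsetI)
  fix z assume z: "z \<in> cantor m"
  obtain parse where words: "\<And>N. parse N \<in> words n" and len: "\<And>N. length (parse N) = N"
    and pref: "\<And>N. pref_inf (subst_word e (parse N)) z"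
    using subst_word_exists[OF z] by metis
  define x where "x i = parse (Suc i) ! i" for i
  have "parse (Suc i) ! i \<in> set (parse (Suc i))" for i using len[of "Suc i"] by simp
  then have x: "x \<in> cantor n"
    using words by (auto simp: x_def cantor_def words_def)
  have "map x [0..<N] = parse N" for N
  proof (induction N)
    case (Suc N)
    have split: "parse (Suc N) = take N (parse (Suc N)) @ [x N]"
      unfolding x_def using len[of "Suc N"]
      by (metis lessI order_refl take_Suc_conv_app_nth take_all)
    have "pref_inf (subst_word e (take N (parse (Suc N)) @ [x N])) z"
      using pref[of "Suc N"] by (subst split[symmetric])
    then have "pref_inf (subst_word e (take N (parse (Suc N)))) z"
      unfolding subst_word_append by (rule pref_inf_appendD)
    then have "take N (parse (Suc N)) = parse N"
      using subst_word_unique[OF _ _ words z _ pref] words[of "Suc N"] split len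
      by (metis append_in_words_iff length_take min.absorb2 nat_le_linear not_less_eq_eq)
    then show ?case using split Suc.IH by simp
  qed (use len[of 0] in simp)
  then have "subst_inf e x = z" using pref by (intro subst_inf_eqI[OF x, of 0]) simp
  then show "z \<in> subst_inf e ` cantor n" using x by blast
qed (use subst_inf_in in blast)

lemma pref_inf_subst_iff:
  assumes "p \<in> words n" "x \<in> cantor n"
  shows "pref_inf (subst_word e p) (subst_inf e x) \<longleftrightarrow> pref_inf p x"
proof
  assume "pref_inf p x"
  then obtain y where "y \<in> cantor n" "x = conc p y" using pref_infE assms(2) by blast
  then show "pref_inf (subst_word e p) (subst_inf e x)"
    using subst_inf_conc[OF assms(1)] by simp
next
  assume pref: "pref_inf (subst_word e p) (subst_inf e x)"
  have "pref_inf (subst_word e (map x [0..<length p])) (subst_inf e x)"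
    using pref_inf_subst_inf[OF assms(2)] .
  then have "map x [0..<length p] = p"
    using subst_word_unique[OF _ map_upt_in_words[OF assms(2)] assms(1)
      subst_inf_in[OF assms(2)] _ pref]
    by simp
  then show "pref_inf p x" by (simp add: pref_inf_iff_map)
qed

lemma codomain_alphabet_nonempty: "0 < m"
  using subst_inf_in[OF zero_in_cantor] n_ge2 by (auto simp: cantor_def)

end

section \<open>Extending a self-map along an injection\<close>

definition extend_along :: "('a \<Rightarrow> 'b) \<Rightarrow> 'a set \<Rightarrow> ('a \<Rightarrow> 'a) \<Rightarrow> 'b \<Rightarrow> 'b" where
  "extend_along \<phi> X T y = (if y \<in> \<phi> ` X then \<phi> (T (inv_into X \<phi> y)) else y)"

lemma extend_along_image: "inj_on \<phi> X \<Longrightarrow> x \<in> X \<Longrightarrow> extend_along \<phi> X T (\<phi> x) = \<phi> (T x)"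
  by (simp add: extend_along_def)

lemma extend_along_outside: "y \<notin> \<phi> ` X \<Longrightarrow> extend_along \<phi> X T y = y"
  by (simp add: extend_along_def)

lemma extend_along_comp:
  assumes "inj_on \<phi> X" "\<And>x. x \<in> X \<Longrightarrow> T x \<in> X" "\<And>x. x \<in> X \<Longrightarrow> R x = S (T x)"
  shows "extend_along \<phi> X R = extend_along \<phi> X S \<circ> extend_along \<phi> X T"
proof
  fix y
  show "extend_along \<phi> X R y = (extend_along \<phi> X S \<circ> extend_along \<phi> X T) y"
    using assms by (cases "y \<in> \<phi> ` X") (auto simp: extend_along_image extend_along_outside)
qed

lemma bij_betw_extend_along:
  assumes \<phi>: "inj_on \<phi> X" "\<phi> ` X \<subseteq> Y" and T: "bij_betw T X X"
  shows "bij_betw (extend_along \<phi> X T) Y Y"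
proof -
  have "bij_betw (\<phi> \<circ> T \<circ> inv_into X \<phi>) (\<phi> ` X) (\<phi> ` X)"
    using bij_betw_inv_into[OF inj_on_imp_bij_betw] T inj_on_imp_bij_betw
    by (intro bij_betw_trans) (use \<phi>(1) in blast)+
  then have "bij_betw (extend_along \<phi> X T) (\<phi> ` X) (\<phi> ` X)"
    by (rule bij_betw_cong[THEN iffD1, rotated]) (simp add: extend_along_def)
  moreover have "bij_betw (extend_along \<phi> X T) (Y - \<phi> ` X) (Y - \<phi> ` X)"
    by (rule bij_betw_cong[THEN iffD2, OF _ bij_betw_id]) (simp add: extend_along_outside)
  ultimately have "bij_betw (extend_along \<phi> X T) (\<phi> ` X \<union> (Y - \<phi> ` X)) (\<phi> ` X \<union> (Y - \<phi> ` X))"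
    by (rule bij_betw_combine) blast
  then show ?thesis using \<phi>(2) by (simp add: Un_absorb1)
qed

section \<open>The embedding\<close>

locale cone_embedding = code_substitution +
  fixes H :: "(nat \<Rightarrow> nat) set" and C :: "nat list set" and address :: "(nat \<Rightarrow> nat) \<Rightarrow> nat list"
  assumes H: "perm_subgroup n H" and C: "prefix_code m C"
    and address_inj: "inj_on address H" and address_in: "\<And>k. k \<in> H \<Longrightarrow> address k \<in> C"
begin

fun chart :: "(nat \<Rightarrow> nat) \<times> (nat \<Rightarrow> nat) \<Rightarrow> nat \<Rightarrow> nat" where
  "chart (k, x) = conc (address k) (subst_inf e (k \<circ> x))"

definition chart_word :: "(nat \<Rightarrow> nat) \<Rightarrow> nat list \<Rightarrow> nat list" where
  "chart_word k p = address k @ subst_word e (map k p)"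

definition embedding :: "((nat \<Rightarrow> nat) \<Rightarrow> nat \<Rightarrow> nat) \<Rightarrow> (nat \<Rightarrow> nat) \<Rightarrow> nat \<Rightarrow> nat" where
  "embedding f = extend_along chart (H \<times> cantor n) (skew_product n f)"

lemma comp_in_cantor: "k \<in> H \<Longrightarrow> x \<in> cantor n \<Longrightarrow> k \<circ> x \<in> cantor n"
  using permutes_comp_cantor perm_subgroup_permutes[OF H] .

lemma map_in_words: "k \<in> H \<Longrightarrow> p \<in> words n \<Longrightarrow> map k p \<in> words n"
  using permutes_map_words perm_subgroup_permutes[OF H] .

lemma chart_image_subset: "chart ` (H \<times> cantor n) \<subseteq> cantor m"
  using conc_in_cantor prefix_code_words[OF C address_in] subst_inf_in comp_in_cantor by auto

lemma chart_word_in: "k \<in> H \<Longrightarrow> p \<in> words n \<Longrightarrow> chart_word k p \<in> words m"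
  using prefix_code_words[OF C address_in] subst_word_in map_in_words by (simp add: chart_word_def)

lemma chart_inj: "inj_on chart (H \<times> cantor n)"
proof (rule inj_onI, clarify)
  fix k x l y
  assume k: "k \<in> H" "l \<in> H" and x: "x \<in> cantor n" "y \<in> cantor n"
    and eq: "chart (k, x) = chart (l, y)"
  have "chart (k, x) \<in> cantor m" using chart_image_subset k x by blast
  moreover have "pref_inf (address k) (chart (k, x))" by simp
  moreover have "pref_inf (address l) (chart (k, x))" unfolding eq by simp
  ultimately have "k = l" using prefix_code_unique[OF C] address_in k address_inj by (metis inj_onD)
  then have "subst_inf e (k \<circ> x) = subst_inf e (k \<circ> y)" using eq by simp
  then have "k \<circ> x = k \<circ> y"
    using inj_onD[OF subst_inf_inj] comp_in_cantor k x by blast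
  then have "x = y"
    using permutes_inj[OF perm_subgroup_permutes[OF H k(1)]] by (simp add: fun_eq_iff inj_eq)
  with \<open>k = l\<close> show "k = l \<and> x = y" ..
qed

lemma chart_conc:
  assumes "k \<in> H" "p \<in> words n" "u \<in> cantor n"
  shows "chart (k, conc p u) = conc (chart_word k p) (subst_inf e (k \<circ> u))"
  using subst_inf_conc[OF map_in_words comp_in_cantor] assms
  by (simp add: chart_word_def comp_conc conc_append)

lemma embedding_chart:
  assumes "k \<in> H" "x \<in> cantor n"
  shows "embedding f (chart (k, x)) = chart (k \<circ> inv (local_perm n f x), f x)"
  using extend_along_image[OF chart_inj] assms by (simp add: embedding_def del: chart.simps)

lemma embedding_comp:
  assumes "f \<in> Vset n H" "g \<in> Vset n H"
  shows "embedding (f \<circ> g) = embedding f \<circ> embedding g"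
  unfolding embedding_def
proof (rule extend_along_comp[OF chart_inj])
  show "skew_product n g kx \<in> H \<times> cantor n" if "kx \<in> H \<times> cantor n" for kx
    using bij_betw_apply[OF bij_betw_skew_product[OF n_ge2 H assms(2)] that] .
  show "skew_product n (f \<circ> g) kx = skew_product n f (skew_product n g kx)"
    if "kx \<in> H \<times> cantor n" for kx
    using skew_product_comp[OF n_ge2 H assms] that by (cases kx) blast
qed

lemma embedding_inj: "inj_on embedding (Vset n H)"
proof (rule inj_onI)
  fix f g assume f: "f \<in> Vset n H" and g: "g \<in> Vset n H" and eq: "embedding f = embedding g"
  have in_H: "id \<circ> inv (local_perm n f' x) \<in> H" if "f' \<in> Vset n H" "x \<in> cantor n" for f' x
    using perm_subgroup_inv[OF H local_perm_in[OF n_ge2 H that]] by simp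
  show "f = g"
  proof
    fix x
    show "f x = g x"
    proof (cases "x \<in> cantor n")
      case True
      have "chart (id \<circ> inv (local_perm n f x), f x) = chart (id \<circ> inv (local_perm n g x), g x)"
        using embedding_chart[OF perm_subgroup_id[OF H] True] eq by metis
      from inj_onD[OF chart_inj this] show ?thesis
        using in_H[OF f True] in_H[OF g True] Vset_maps_cantor[OF f H True]
          Vset_maps_cantor[OF g H True]
        by blast
    next
      case False
      then show ?thesis using Vset_outside[OF f] Vset_outside[OF g] by simp
    qed
  qed
qed

lemma embedding_acts_on_chart_cone:
  assumes k: "k \<in> H" and h: "h \<in> H" and p: "p \<in> words n" and q: "q \<in> words n"
    and act: "acts_on_cone n f p q h"
  shows "acts_on_cone m (embedding f) (chart_word k p) (chart_word (k \<circ> inv h) q) id"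
  unfolding acts_on_cone_def
proof
  fix u assume "u \<in> cantor m"
  then obtain y where y: "y \<in> cantor n" "u = subst_inf e y" using subst_inf_surj by blast
  define v where "v = inv k \<circ> y"
  have v: "v \<in> cantor n"
    using comp_in_cantor[OF perm_subgroup_inv[OF H k] y(1)] by (simp add: v_def)
  have kv: "k \<circ> v = y"
    using permutes_comp_inv_cancel(3)[OF perm_subgroup_permutes[OF H k]] by (simp add: v_def)
  have h': "h permutes {..<n}" and kh: "k \<circ> inv h \<in> H" and hv: "h \<circ> v \<in> cantor n"
    using perm_subgroup_permutes[OF H h] perm_subgroup_comp[OF H k perm_subgroup_inv[OF H h]]
      comp_in_cantor[OF h v] by auto
  have pv: "conc p v \<in> cantor n" using conc_in_cantor[OF p v] .
  have "embedding f (conc (chart_word k p) u) = embedding f (chart (k, conc p v))"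
    using chart_conc[OF k p v] kv y(2) by simp
  also have "\<dots> = chart (k \<circ> inv h, conc q (h \<circ> v))"
    using embedding_chart[OF k pv] local_perm_eq[OF n_ge2 pv h' pref_inf_conc act]
      acts_on_coneD[OF act v] by simp
  also have "\<dots> = conc (chart_word (k \<circ> inv h) q) (subst_inf e (k \<circ> inv h \<circ> (h \<circ> v)))"
    using chart_conc[OF kh q hv] .
  also have "k \<circ> inv h \<circ> (h \<circ> v) = y"
    unfolding comp_assoc[symmetric] permutes_comp_inv_cancel(1)[OF h'] by (rule kv)
  finally show "embedding f (conc (chart_word k p) u) = conc (chart_word (k \<circ> inv h) q) (id \<circ> u)"
    unfolding y(2) id_comp .
qed

lemma embedding_acts_on_spare_cone:
  assumes "d \<in> C" "d \<notin> address ` H"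
  shows "acts_on_cone m (embedding f) d d id"
  unfolding acts_on_cone_def
proof
  fix u assume "u \<in> cantor m"
  then have z: "conc d u \<in> cantor m" using conc_in_cantor prefix_code_words[OF C assms(1)] by blast
  have "conc d u \<noteq> chart (k, x)" if k: "k \<in> H" for k x
  proof
    assume "conc d u = chart (k, x)"
    then have "pref_inf (address k) (conc d u)" by simp
    then have "address k = d" using prefix_code_unique[OF C z address_in[OF k] assms(1)] by simp
    then show False using assms(2) k by blast
  qed
  then have "conc d u \<notin> chart ` (H \<times> cantor n)" by blast
  then show "embedding f (conc d u) = conc d (id \<circ> u)"
    by (simp add: embedding_def extend_along_outside)
qed

definition sheet_code :: "nat list set \<Rightarrow> nat list \<Rightarrow> nat list set" where
  "sheet_code P d =
     (if d \<in> address ` H then (\<lambda>p. subst_word e (map (inv_into H address d) p)) ` P else {[]})"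

lemma prefix_code_sheet_code:
  assumes P: "prefix_code n P"
  shows "prefix_code m (sheet_code P d)"
proof (cases "d \<in> address ` H")
  case True
  then have k: "inv_into H address d \<in> H" (is "?k \<in> H") by (rule inv_into_into)
  then have perm: "?k permutes {..<n}" using perm_subgroup_permutes[OF H] by blast
  have "prefix_code m ((\<lambda>p. subst_word e (map ?k p)) ` P)"
  proof (rule prefix_code_transport[OF P, where \<phi> = "\<lambda>x. subst_inf e (?k \<circ> x)"])
    show "(\<lambda>x. subst_inf e (?k \<circ> x)) ` cantor n = cantor m"
      using subst_inf_surj permutes_comp_cantor_image[OF perm] by (metis image_image)
    show "subst_word e (map ?k p) \<in> words m" if "p \<in> words n" for p
      using subst_word_in[OF map_in_words[OF k that]] .
    show "pref_inf (subst_word e (map ?k p)) (subst_inf e (?k \<circ> x)) \<longleftrightarrow> pref_inf p x"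
      if "p \<in> words n" "x \<in> cantor n" for p x
      using pref_inf_subst_iff[OF map_in_words[OF k that(1)] comp_in_cantor[OF k that(2)]]
        pref_inf_map_comp[OF permutes_inj[OF perm]] by simp
  qed
  then show ?thesis using True by (simp add: sheet_code_def)
next
  case False
  then show ?thesis using prefix_code_Nil by (simp add: sheet_code_def)
qed

lemma embedding_acts_on_sheet_code:
  assumes P: "prefix_code n P"
    and act: "\<And>p. p \<in> P \<Longrightarrow> \<exists>q\<in>words n. \<exists>h\<in>H. acts_on_cone n f p q h"
    and d: "d \<in> C" "t \<in> sheet_code P d"
  shows "\<exists>q\<in>words m. acts_on_cone m (embedding f) (d @ t) q id"
proof (cases "d \<in> address ` H")
  case True
  then obtain k where k: "k \<in> H" "d = address k" by blast
  then obtain p where p: "p \<in> P" "d @ t = chart_word k p"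
    using d address_inj by (auto simp: sheet_code_def chart_word_def)
  obtain q h where q: "q \<in> words n" "h \<in> H" "acts_on_cone n f p q h"
    using act[OF p(1)] by blast
  have "acts_on_cone m (embedding f) (d @ t) (chart_word (k \<circ> inv h) q) id"
    using embedding_acts_on_chart_cone[OF k(1) q(2) prefix_code_words[OF P p(1)] q(1,3)] p(2)
    by simp
  moreover have "chart_word (k \<circ> inv h) q \<in> words m"
    using chart_word_in[OF perm_subgroup_comp[OF H k(1) perm_subgroup_inv[OF H q(2)]] q(1)] .
  ultimately show ?thesis by blast
next
  case False
  then have "d @ t = d" using d by (simp add: sheet_code_def)
  then show ?thesis
    using embedding_acts_on_spare_cone[OF d(1) False] prefix_code_words[OF C d(1)] by auto
qed

lemma embedding_in_Vset:
  assumes f: "f \<in> Vset n H" and G: "perm_subgroup m G"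
  shows "embedding f \<in> Vset m G"
proof (rule Vset_cone_actions[OF f H])
  fix P Q h
  assume P: "prefix_code n P" and Q: "prefix_code n (Q ` P)"
    and act: "\<And>p. p \<in> P \<Longrightarrow> h p \<in> H" "\<And>p. p \<in> P \<Longrightarrow> acts_on_cone n f p (Q p) (h p)"
  show ?thesis
  proof (rule VsetI[OF G codomain_alphabet_nonempty])
    show "embedding f z = z" if "z \<notin> cantor m" for z
      unfolding embedding_def using chart_image_subset that by (intro extend_along_outside) blast
    show "bij_betw (embedding f) (cantor m) (cantor m)"
      unfolding embedding_def
      by (rule bij_betw_extend_along[OF chart_inj chart_image_subset
            bij_betw_skew_product[OF n_ge2 H f]])
    show "prefix_code m (\<Union>d\<in>C. (@) d ` sheet_code P d)"
      by (rule prefix_code_append[OF C prefix_code_sheet_code[OF P]])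
  next
    have act': "\<exists>q\<in>words n. \<exists>h\<in>H. acts_on_cone n f p q h" if "p \<in> P" for p
      using act prefix_code_words[OF Q] that by blast
    fix s assume "s \<in> (\<Union>d\<in>C. (@) d ` sheet_code P d)"
    then obtain d t where "d \<in> C" "t \<in> sheet_code P d" "s = d @ t" by blast
    then show "\<exists>q\<in>words m. \<exists>g\<in>G. acts_on_cone m (embedding f) s q g"
      using embedding_acts_on_sheet_code[OF P act'] perm_subgroup_id[OF G] by blast
  qed
qed

lemma embedding_hom: "perm_subgroup m G \<Longrightarrow> embedding \<in> hom (Vgrp n H) (Vgrp m G)"
  using embedding_in_Vset embedding_comp by (auto simp: Vgrp_def hom_def)

end

lemma exists_injection_into_prefix_code:
  assumes "2 \<le> m" "finite B"
  obtains D w where "prefix_code m D" "inj_on w B" "w ` B \<subseteq> D"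
proof -
  define D where "D = {v \<in> words m. length v = card B}"
  have D: "prefix_code m D" unfolding D_def by (rule prefix_code_uniform)
  have "card B \<le> 2 ^ card B" using less_exp[of "card B"] by simp
  also have "\<dots> \<le> m ^ card B" using assms(1) by (rule power_mono) simp
  also have "\<dots> = card {v. set v \<subseteq> {..<m} \<and> length v = card B}"
    by (simp add: card_lists_length_eq)
  also have "{v. set v \<subseteq> {..<m} \<and> length v = card B} = D" by (auto simp: D_def words_def)
  finally obtain w where "w ` B \<subseteq> D" "inj_on w B"
    using card_le_inj[OF assms(2) prefix_code_finite[OF D]] by blast
  with D show thesis using that by blast
qed

lemma Vgrp_embedding_of_prefix_code:
  assumes "2 \<le> m" "2 \<le> card A" "prefix_code m A" "perm_subgroup m G" "perm_subgroup (card A) H"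
  shows "\<exists>\<phi>. \<phi> \<in> hom (Vgrp (card A) H) (Vgrp m G) \<and> inj_on \<phi> (carrier (Vgrp (card A) H))"
proof -
  obtain e where e: "bij_betw e {..<card A} A"
    using ex_bij_betw_nat_finite[OF prefix_code_finite[OF assms(3)]] by (metis atLeast0LessThan)
  obtain D w where w: "prefix_code m D" "inj_on w H" "w ` H \<subseteq> D"
    using exists_injection_into_prefix_code[OF assms(1) perm_subgroup_finite[OF assms(5)]] by metis
  interpret cone_embedding m "card A" e A H D w
    by unfold_locales (use assms e w in auto)
  show ?thesis
    using embedding_hom[OF assms(4)] embedding_inj by (auto simp: Vgrp_def)
qed

theorem theorem1p1:
  fixes m n :: nat and G H :: "(nat \<Rightarrow> nat) set" and A :: "nat list set"
  assumes "m \<ge> 2" and "n \<ge> 2" and "m < n"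
    and "perm_subgroup m G" and "perm_subgroup n H"
    and "prefix_code m A" and "card A = n"
    and "root_well_defined G A"
    and "cyclically_isomorphic n (root_group G A) H"
  shows "\<exists>\<phi>. \<phi> \<in> hom (Vgrp n H) (Vgrp m G) \<and> inj_on \<phi> (carrier (Vgrp n H))"
  using Vgrp_embedding_of_prefix_code[of m A G H] assms by simp

end
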